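(* Let $s>-1/2$ and, for each $\delta>0$ and each $y^\delta\in Y$ with $\|y^\delta-y\|\le\delta$, let $f^\delta(t)$ be the dynamic solution of $$\ddot f^\delta(t)+\frac{1+2s}{t}\dot f^\delta(t)+K^*Kf^\delta(t)=K^*y^\delta,\qquad f^\delta(0)=f_0,\quad \dot f^\delta(0)=0 .$$ If the terminating time $T_*=T_*(\delta,y^\delta)$ is chosen so that $$\lim_{\delta\to0}T_*=\infty\quad\text{and}\quad\lim_{\delta\to0}\delta\cdot T_*=0,$$ then the approximate solution $f^\delta(T_* )$ converges strongly in $Q$ to $f^\dagger$ as $\delta\to0$.
   Context: $Q$ and $Y$ are infinite-dimensional Hilbert spaces (inner products $\langle\cdot,\cdot\rangle$, norms $\|\cdot\|$). $K:Q\to Y$ is a compact linear operator whose range $\mathcal R(K)$ is infinite-dimensional, and $K^*$ is its adjoint. $y\in\mathcal R(K)$ is the exact right-hand side, $y^\delta\in Y$ is noisy data with $\|y^\delta-y\|\le\delta$, and $\delta>0$ is known. $f^\dagger$ is the unique minimum-norm solution of $Kf=y$. $f_0\in Q$ is an initial guess. Let $\{\lambda_j;u_j,v_j\}_{j\ge1}$ be the singular system of $K$: $Ku_j=\lambda_jv_j$, $K^*v_j=\lambda_ju_j$, $\|K\|=\lambda_1\ge\lambda_2\ge\cdots>0$, $\lambda_j\to0$, with $\{u_j\}$ an orthonormal basis of $N(K)^\perp$. By convention, the dynamic solution is taken in $N(K)^\perp$ (the component in $N(K)$ is dropped), i.e. $f^\delta(t)=\sum_j\xi_j(t)u_j$,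 where $\xi_j$ solves $\ddot\xi_j+\frac{1+2s}{t}\dot\xi_j+\lambda_j^2\xi_j=\lambda_j\langle y^\delta,v_j\rangle$, $\xi_j(0)=\langle f_0,u_j\rangle$, $\dot\xi_j(0)=0$. Explicitly, $$f^\delta(t)=\sum_j 2^s\Gamma(s+1)\frac{J_s(\lambda_jt)}{(\lambda_jt)^s}\langle f_0,u_j\rangle u_j+\sum_j\Big(1-2^s\Gamma(s+1)\frac{J_s(\lambda_jt)}{(\lambda_jt)^s}\Big)\lambda_j^{-1}\langle y^\delta,v_j\rangle u_j ,$$ where $J_s$ is the Bessel function of the first kind of order $s$, and $J_s(\lambda_jt)/(\lambda_jt)^s$ is understood as its limit $1/(2^s\Gamma(s+1))$ at $t=0$. *)

theory Defs
  imports "HOL-Analysis.Analysis"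
begin

definition infinite_dimensional :: "'a::real_vector set \<Rightarrow> bool" where
  "infinite_dimensional S \<longleftrightarrow> \<not> (\<exists>B. finite B \<and> S \<subseteq> span B)"

definition compact_operator :: "('a::real_normed_vector \<Rightarrow> 'b::real_normed_vector) \<Rightarrow> bool" where
  "compact_operator K \<longleftrightarrow> linear K \<and> (\<forall>S. bounded S \<longrightarrow> compact (closure (K ` S)))"

definition null_space :: "('a::real_vector \<Rightarrow> 'b::real_vector) \<Rightarrow> 'a set" where
  "null_space K = {x. K x = 0}"

(* The derivative at t = 0 is one-sided, and the equation, being singular there, is imposed
   for t > 0 only. The values of F at negative times are irrelevant. *)
definition ivp_solution ::
  "('q::real_inner \<Rightarrow> 'y::real_inner) \<Rightarrow> real \<Rightarrow> 'q \<Rightarrow> 'y \<Rightarrow> (real \<Rightarrow> 'q) \<Rightarrow> bool" where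
  "ivp_solution K s f0 z F \<longleftrightarrow>
     (\<exists>F' F''.
        F 0 = f0 \<and> F' 0 = 0 \<and>
        (\<forall>t\<ge>0. (F has_vector_derivative F' t) (at t within {0..})) \<and>
        (\<forall>t>0. (F' has_vector_derivative F'' t) (at t)) \<and>
        (\<forall>t>0. F'' t + ((1 + 2 * s) / t) *\<^sub>R F' t + adjoint K (K (F t)) = adjoint K z))"

(* By convention the component in the null space of K is dropped from the solution of the
   initial value problem. If (u j) is an orthonormal basis of the orthogonal complement of the
   null space consisting of singular vectors of K, then f t is the sum over j of
   (F t \<bullet> u j) *\<^sub>R u j, and each coefficient solves the corresponding scalar problem. *)
definition dynamic_solution ::
  "('q::real_inner \<Rightarrow> 'y::real_inner) \<Rightarrow> real \<Rightarrow> 'q \<Rightarrow> 'y \<Rightarrow> (real \<Rightarrow> 'q) \<Rightarrow> bool" where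
  "dynamic_solution K s f0 z f \<longleftrightarrow>
     (\<exists>F. ivp_solution K s f0 z F \<and>
        (\<forall>t\<ge>0. f t \<in> orthogonal_comp (null_space K) \<and> F t - f t \<in> null_space K))"

(* The filter "d tends to 0 from above, uniformly over all data z with norm (z - y) \<le> d". *)
definition noise_limit :: "'y::real_normed_vector \<Rightarrow> (real \<times> 'y) filter" where
  "noise_limit y =
     inf (filtercomap fst (at_right 0)) (principal {(d, z). norm (z - y) \<le> d})"

end

theory Submission
  imports Defs
begin

text \<open>
  Let \<open>u\<close> be a unit singular vector of \<open>K\<close> with singular value \<open>l = norm (K u)\<close>, and write
  \<open>\<phi>(t)\<close> for the solution of \<open>\<phi>'' + (1 + 2s)/t \<phi>' + l\<^sup>2 \<phi> = 0\<close> with \<open>\<phi> 0 = 1\<close> and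
  \<open>\<phi>' 0 = 0\<close>, which is a multiple of \<open>J\<^sub>s(l t) / (l t)\<^sup>s\<close>. Along \<open>u\<close> the error
  \<open>f(t) - fdag\<close> has the coefficient
  \<open>\<phi>(t) (f0 - fdag) \<bullet> u + (1 - \<phi>(t)) l\<^sup>-\<^sup>1 (z - y) \<bullet> v\<close> with \<open>v = K u / l\<close>. Three properties of \<open>\<phi>\<close>
  suffice: \<open>\<bar>\<phi>\<bar> \<le> 1\<close>, \<open>\<bar>1 - \<phi>(t)\<bar> \<le> l t\<close>, and \<open>\<phi>(t) \<longlongrightarrow> 0\<close> as \<open>t \<longlongrightarrow> \<infinity>\<close>. The second one
  cancels the factor \<open>l\<^sup>-\<^sup>1\<close>, so that by the inequality of Bessel the noise contributes at most
  \<open>t norm (z - y)\<close>, which is at most \<open>\<delta> T\<close>. In the contribution of the initial error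
  \<open>f0 - fdag\<close> all but finitely many coefficients have a small square sum, which the first property
  preserves, and the remaining ones tend to zero by the third, as \<open>T\<close> tends to infinity.

  No Bessel functions occur below: the three properties are derived from the differential equation
  for an arbitrary solution \<open>p\<close>, with \<open>\<phi>(t)\<close> replaced by \<open>p t / p 0\<close>. The energy
  \<open>(p'\<^sup>2 + l\<^sup>2 p\<^sup>2) / 2\<close> is nonincreasing because the term in \<open>p'\<close> is a friction term, and this gives the
  first two properties (\<open>factor_bounded\<close>). Decay (\<open>damped_oscillator_factor_decay\<close>) follows from
  adding a small multiple of \<open>p p'\<close> to the energy, which makes the friction act on \<open>p\<close> too.
  In both steps \<open>s > -1/2\<close> is what makes the friction coefficient \<open>1 + 2s\<close> positive.

  The passage from coefficients to the error itself needs an orthonormal set of singular vectors that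
  spans a dense subspace of the orthogonal complement of the null space
  (\<open>singular_basis_exists\<close>); the error lies in that complement, because the dynamic solution does so
  by convention and \<open>fdag\<close> does so by minimality of its norm. Such a set comes from the variational
  construction of singular vectors of a compact operator. The only other facts on Hilbert spaces are
  the projection theorem and, derived from it, the theorem of Riesz, without which \<open>adjoint K\<close> would
  be an arbitrary choice.
\<close>

section \<open>Projections and adjoints in Hilbert spaces\<close>

text \<open>
  The quadratic polynomial \<open>norm (w + t x)\<^sup>2\<close> in \<open>t\<close> has its minimum at \<open>0\<close> only if its linear coefficient
  vanishes.
\<close>
lemma inner_eq_0_if_norm_minimal:
  fixes w x :: "'a::real_inner"
  assumes "\<And>t. norm w \<le> norm (w + t *\<^sub>R x)"
  shows "w \<bullet> x = 0"
proof (cases "x = 0")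
  case False
  define t where "t = - (w \<bullet> x) / (x \<bullet> x)"
  have pos: "x \<bullet> x > 0"
    using False by simp
  have "w \<bullet> w \<le> (w + t *\<^sub>R x) \<bullet> (w + t *\<^sub>R x)"
    using assms[of t] by (simp add: norm_le)
  also have "\<dots> = w \<bullet> w - (w \<bullet> x)\<^sup>2 / (x \<bullet> x)"
    using pos by (simp add: t_def inner_add inner_diff inner_commute[of x w] power2_eq_square field_simps)
  finally have "(w \<bullet> x)\<^sup>2 / (x \<bullet> x) \<le> 0"
    by simp
  then show ?thesis
    using pos by (simp add: divide_le_0_iff)
qed simp

text \<open>
  A sequence in \<open>S\<close> whose distances to \<open>v\<close> tend to the infimum is Cauchy by the parallelogram
  law: midpoints stay in \<open>S\<close> and cannot be closer to \<open>v\<close> than the infimum. Its limit \<open>p\<close>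
  minimises the distance to \<open>v\<close>. Since \<open>S\<close> need not be closed, \<open>p\<close> is only in the closure.
\<close>
lemma projection_exists:
  fixes S :: "'a::{real_inner, complete_space} set"
  assumes "subspace S"
  shows "\<exists>p\<in>closure S. \<forall>x\<in>S. (v - p) \<bullet> x = 0"
proof -
  define q where "q = (INF x\<in>S. (norm (v - x))\<^sup>2)"
  have S0: "0 \<in> S"
    using assms by (simp add: subspace_0)
  have bdd: "bdd_below ((\<lambda>x. (norm (v - x))\<^sup>2) ` S)"
    by (rule bdd_belowI2[of _ 0]) simp
  have q_le: "q \<le> (norm (v - x))\<^sup>2" if "x \<in> S" for x
    unfolding q_def using bdd that by (rule cINF_lower)
  have "\<exists>x\<in>S. (norm (v - x))\<^sup>2 < q + inverse (real (Suc n))" for n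
  proof -
    have "q < q + inverse (real (Suc n))"
      by simp
    then show ?thesis
      unfolding q_def using S0 bdd by (subst (asm) cINF_less_iff) auto
  qed
  then obtain X where X: "\<And>n. X n \<in> S" "\<And>n. (norm (v - X n))\<^sup>2 < q + inverse (real (Suc n))"
    by metis
  have par: "(norm (X m - X n))\<^sup>2 \<le> 2 * inverse (real (Suc m)) + 2 * inverse (real (Suc n))" for m n
  proof -
    have "(1/2) *\<^sub>R (X m + X n) \<in> S"
      using X(1) assms by (simp add: subspace_add subspace_scale)
    then have "q \<le> (norm (v - (1/2) *\<^sub>R (X m + X n)))\<^sup>2"
      by (rule q_le)
    moreover have "(norm (X m - X n))\<^sup>2 = 2 * (norm (v - X m))\<^sup>2 + 2 * (norm (v - X n))\<^sup>2
        - 4 * (norm (v - (1/2) *\<^sub>R (X m + X n)))\<^sup>2"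
      by (simp add: power2_norm_eq_inner inner_diff inner_add inner_commute algebra_simps)
    ultimately show ?thesis
      using X(2)[of m] X(2)[of n] by linarith
  qed
  have "Cauchy X"
  proof (rule metric_CauchyI)
    fix e :: real assume e: "e > 0"
    then obtain N where N: "inverse (real (Suc N)) < e\<^sup>2 / 4"
      using reals_Archimedean[of "e\<^sup>2 / 4"] by auto
    show "\<exists>M. \<forall>m\<ge>M. \<forall>n\<ge>M. dist (X m) (X n) < e"
    proof (intro exI allI impI)
      fix m n assume "N \<le> m" "N \<le> n"
      then have "inverse (real (Suc m)) \<le> inverse (real (Suc N))"
        "inverse (real (Suc n)) \<le> inverse (real (Suc N))"
        by (simp_all add: le_imp_inverse_le)
      with par[of m n] N have "(norm (X m - X n))\<^sup>2 < e\<^sup>2"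
        by linarith
      then show "dist (X m) (X n) < e"
        using e by (simp add: dist_norm power2_less_imp_less)
    qed
  qed
  then obtain p where p: "X \<longlonglongrightarrow> p"
    using Cauchy_convergent_iff convergent_def by blast
  have p_clos: "p \<in> closure S"
    using X(1) p by (auto simp: closure_sequential)
  have lim: "(\<lambda>n. (norm (v - X n))\<^sup>2) \<longlonglongrightarrow> (norm (v - p))\<^sup>2"
    by (intro tendsto_intros p)
  have "(\<lambda>n. q + inverse (real (Suc n))) \<longlonglongrightarrow> q + 0"
    by (intro tendsto_intros LIMSEQ_inverse_real_of_nat)
  then have pq: "(norm (v - p))\<^sup>2 \<le> q"
    using X(2) by (intro LIMSEQ_le[OF lim]) (auto intro: less_imp_le)
  have "(v - p) \<bullet> x = 0" if x: "x \<in> S" for x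
  proof (rule inner_eq_0_if_norm_minimal)
    fix t
    have "(\<lambda>n. (norm (v - X n + t *\<^sub>R x))\<^sup>2) \<longlonglongrightarrow> (norm (v - p + t *\<^sub>R x))\<^sup>2"
      by (intro tendsto_intros p)
    moreover have "q \<le> (norm (v - X n + t *\<^sub>R x))\<^sup>2" for n
      using q_le[of "X n - t *\<^sub>R x"] X(1) x assms
      by (simp add: subspace_diff subspace_scale algebra_simps)
    ultimately have "q \<le> (norm (v - p + t *\<^sub>R x))\<^sup>2"
      by (intro LIMSEQ_le_const) auto
    with pq show "norm (v - p) \<le> norm (v - p + t *\<^sub>R x)"
      by (meson norm_ge_zero order_trans power2_le_imp_le)
  qed
  with p_clos show ?thesis
    by blast
qed

text \<open>
  The representing vector is a multiple of the component \<open>w\<close> of some \<open>v\<close> orthogonal to the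
  kernel, since the kernel has codimension one: \<open>\<phi> x w - \<phi> w x\<close> always lies in it.
\<close>
lemma riesz_representation:
  fixes \<phi> :: "'a::{real_inner, complete_space} \<Rightarrow> real"
  assumes "bounded_linear \<phi>"
  shows "\<exists>b. \<forall>x. \<phi> x = x \<bullet> b"
proof (cases "\<exists>v. \<phi> v \<noteq> 0")
  case True
  then obtain v where v: "\<phi> v \<noteq> 0"
    by blast
  interpret bounded_linear \<phi>
    by (rule assms)
  let ?N = "{x. \<phi> x = 0}"
  have "subspace ?N"
    by (auto simp: subspace_def add scale zero)
  moreover have "closed ?N"
    by (intro closed_Collect_eq continuous_intros continuous_on)
  ultimately obtain p where p: "\<phi> p = 0" "\<And>x. \<phi> x = 0 \<Longrightarrow> (v - p) \<bullet> x = 0"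
    using projection_exists[of ?N v] by auto
  define w where "w = v - p"
  have w: "\<phi> w \<noteq> 0" "w \<noteq> 0"
    using v p by (auto simp: w_def diff)
  have "\<phi> x = x \<bullet> ((\<phi> w / (w \<bullet> w)) *\<^sub>R w)" for x
  proof -
    have "w \<bullet> (\<phi> x *\<^sub>R w - \<phi> w *\<^sub>R x) = 0"
      unfolding w_def by (rule p(2)) (simp add: diff scale)
    then show ?thesis
      using w by (simp add: inner_diff_right field_simps inner_commute)
  qed
  then show ?thesis
    by blast
qed (auto intro: exI[of _ 0])

text \<open>
  The constant \<open>adjoint\<close> is a Hilbert choice and means something only where an adjoint exists; for
  bounded operators on a complete space this is provided by the representation theorem.
\<close>
lemma inner_adjoint:
  fixes K :: "'a::{real_inner, complete_space} \<Rightarrow> 'b::real_inner"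
  assumes "bounded_linear K"
  shows "K x \<bullet> y = x \<bullet> adjoint K y"
proof -
  have "\<exists>b. \<forall>x. K x \<bullet> y = x \<bullet> b" for y
    using assms by (intro riesz_representation bounded_linear_inner_left_comp)
  then have "\<exists>f'. \<forall>x y. K x \<bullet> y = x \<bullet> f' y"
    by metis
  then show ?thesis
    unfolding adjoint_def by (rule someI2_ex) simp
qed

lemma bounded_linear_adjoint:
  fixes K :: "'a::{real_inner, complete_space} \<Rightarrow> 'b::real_inner"
  assumes "bounded_linear K"
  shows "bounded_linear (adjoint K)"
proof -
  note adj = inner_adjoint[OF assms, symmetric]
  obtain B where B: "0 \<le> B" "\<And>x. norm (K x) \<le> norm x * B"
    using bounded_linear.nonneg_bounded[OF assms] by blast
  show ?thesis
  proof (rule bounded_linear_intro)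
    show "adjoint K (x + y) = adjoint K x + adjoint K y" for x y
      by (rule iffD1[OF vector_eq_ldot]) (simp add: adj inner_add_right)
    show "adjoint K (r *\<^sub>R x) = r *\<^sub>R adjoint K x" for r x
      by (rule iffD1[OF vector_eq_ldot]) (simp add: adj)
    show "norm (adjoint K y) \<le> norm y * B" for y
    proof (cases "adjoint K y = 0")
      case True
      then show ?thesis
        using B(1) by simp
    next
      case False
      have "norm (adjoint K y) * norm (adjoint K y) = adjoint K y \<bullet> adjoint K y"
        by (simp add: power2_norm_eq_inner flip: power2_eq_square)
      also have "\<dots> = K (adjoint K y) \<bullet> y"
        by (rule adj)
      also have "\<dots> \<le> norm (K (adjoint K y)) * norm y"
        by (rule norm_cauchy_schwarz)
      also have "\<dots> \<le> (norm (adjoint K y) * B) * norm y"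
        by (intro mult_right_mono B(2)) simp
      finally show ?thesis
        using False by (simp add: mult.assoc mult.commute)
    qed
  qed
qed

section \<open>Orthonormal families\<close>

text \<open>
  A family rather than a set, because the images of a set of singular vectors under \<open>K\<close>, after
  normalisation, are most conveniently indexed by the singular vectors themselves.
\<close>
definition orthonormal :: "('i \<Rightarrow> 'a::real_inner) \<Rightarrow> 'i set \<Rightarrow> bool" where
  "orthonormal e I \<longleftrightarrow> (\<forall>i\<in>I. \<forall>j\<in>I. e i \<bullet> e j = of_bool (i = j))"

lemma orthonormal_subset: "orthonormal e I \<Longrightarrow> J \<subseteq> I \<Longrightarrow> orthonormal e J"
  unfolding orthonormal_def by blast

lemma norm_diff_square: "(norm (v - x))\<^sup>2 = v \<bullet> v - 2 * (v \<bullet> x) + x \<bullet> x"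
  for v x :: "'a::real_inner"
  by (simp add: power2_norm_eq_inner inner_diff inner_commute)

text \<open>
  Completing the square around the Fourier coefficients. The choice of these coefficients for \<open>r\<close>
  gives the inequality of Bessel, and an arbitrary \<open>r\<close> shows that they give the best
  approximation.
\<close>
lemma norm_diff_orthonormal_sum:
  assumes "finite I" "orthonormal e I"
  shows "(norm (v - (\<Sum>i\<in>I. r i *\<^sub>R e i)))\<^sup>2 =
    (norm v)\<^sup>2 - (\<Sum>i\<in>I. (v \<bullet> e i)\<^sup>2) + (\<Sum>i\<in>I. (r i - v \<bullet> e i)\<^sup>2)"
proof -
  have "(\<Sum>i\<in>I. r i *\<^sub>R e i) \<bullet> (\<Sum>i\<in>I. r i *\<^sub>R e i) = (\<Sum>i\<in>I. \<Sum>j\<in>I. r i * r j * of_bool (i = j))"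
    using assms(2) unfolding inner_sum_left inner_sum_right orthonormal_def
    by (intro sum.cong refl) (auto simp: of_bool_def)
  also have "\<dots> = (\<Sum>i\<in>I. (r i)\<^sup>2)"
    using assms(1) by (intro sum.cong refl) (simp add: of_bool_def power2_eq_square if_distrib sum.delta cong: if_cong)
  finally have "(norm (v - (\<Sum>i\<in>I. r i *\<^sub>R e i)))\<^sup>2 =
      (norm v)\<^sup>2 - 2 * (\<Sum>i\<in>I. r i * (v \<bullet> e i)) + (\<Sum>i\<in>I. (r i)\<^sup>2)"
    by (simp add: norm_diff_square inner_sum_right flip: power2_norm_eq_inner)
  moreover have "(\<Sum>i\<in>I. (r i - v \<bullet> e i)\<^sup>2) =
      (\<Sum>i\<in>I. (r i)\<^sup>2) + (\<Sum>i\<in>I. (v \<bullet> e i)\<^sup>2) - 2 * (\<Sum>i\<in>I. r i * (v \<bullet> e i))"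
    unfolding power2_diff sum.distrib sum_subtractf sum_distrib_left by (simp only: mult.assoc)
  ultimately show ?thesis
    by linarith
qed

lemma bessel_inequality:
  assumes "finite I" "orthonormal e I"
  shows "(\<Sum>i\<in>I. (v \<bullet> e i)\<^sup>2) \<le> (norm v)\<^sup>2"
  using norm_diff_orthonormal_sum[OF assms, of v "\<lambda>i. v \<bullet> e i"]
    zero_le_power2[of "norm (v - (\<Sum>i\<in>I. (v \<bullet> e i) *\<^sub>R e i))"]
  by simp

text \<open>
  A form of the identity of Parseval that involves only finite sums, so that no convergence of
  series has to be discussed.
\<close>
lemma norm_le_of_coefficients:
  assumes M: "orthonormal (\<lambda>u. u) M" and v: "v \<in> closure (span M)"
    and C: "\<And>S. finite S \<Longrightarrow> S \<subseteq> M \<Longrightarrow> (\<Sum>u\<in>S. (v \<bullet> u)\<^sup>2) \<le> C"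
  shows "(norm v)\<^sup>2 \<le> C"
proof (rule field_le_epsilon)
  fix e :: real assume e: "e > 0"
  then obtain x where x: "x \<in> span M" "dist x v < sqrt e"
    using v closure_approachable[of v "span M"] by (meson real_sqrt_gt_0_iff)
  then obtain S r where S: "finite S" "S \<subseteq> M" "x = (\<Sum>u\<in>S. r u *\<^sub>R u)"
    unfolding span_explicit by blast
  have "(norm v)\<^sup>2 \<le> (\<Sum>u\<in>S. (v \<bullet> u)\<^sup>2) + (norm (v - x))\<^sup>2"
    using norm_diff_orthonormal_sum[OF S(1) orthonormal_subset[OF M S(2)], of v r]
      sum_nonneg[of S "\<lambda>u. (r u - v \<bullet> u)\<^sup>2"] S(3) by simp
  moreover have "(norm (v - x))\<^sup>2 \<le> (sqrt e)\<^sup>2"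
    using x(2) by (intro power_mono) (auto simp: dist_norm norm_minus_commute)
  ultimately show "(norm v)\<^sup>2 \<le> C + e"
    using C[OF S(1,2)] e by simp
qed

text \<open>
  The finite partial sums are bounded, and a finite set \<open>S\<^sub>0\<close> that nearly attains their supremum
  leaves little for the sets disjoint from it.
\<close>
lemma bessel_tail_small:
  assumes M: "orthonormal e M" and "\<epsilon> > 0"
  shows "\<exists>S\<^sub>0. finite S\<^sub>0 \<and> S\<^sub>0 \<subseteq> M \<and>
    (\<forall>S. finite S \<longrightarrow> S \<subseteq> M - S\<^sub>0 \<longrightarrow> (\<Sum>u\<in>S. (a \<bullet> e u)\<^sup>2) \<le> \<epsilon>)"
proof -
  define \<F> where "\<F> = {S. finite S \<and> S \<subseteq> M}"
  define h where "h S = (\<Sum>u\<in>S. (a \<bullet> e u)\<^sup>2)" for S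
  have bdd: "bdd_above (h ` \<F>)"
    unfolding \<F>_def h_def
    by (rule bdd_aboveI2) (auto intro: bessel_inequality orthonormal_subset[OF M])
  have "{} \<in> \<F>"
    by (simp add: \<F>_def)
  then obtain S\<^sub>0 where S\<^sub>0: "S\<^sub>0 \<in> \<F>" "Sup (h ` \<F>) - \<epsilon> < h S\<^sub>0"
    using less_cSUP_iff[of \<F> h "Sup (h ` \<F>) - \<epsilon>"] bdd \<open>\<epsilon> > 0\<close> by auto
  show ?thesis
  proof (intro exI[of _ S\<^sub>0] conjI allI impI)
    fix S assume S: "finite S" "S \<subseteq> M - S\<^sub>0"
    then have "S \<union> S\<^sub>0 \<in> \<F>"
      using S\<^sub>0 by (auto simp: \<F>_def)
    then have "h (S \<union> S\<^sub>0) \<le> Sup (h ` \<F>)"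
      using bdd by (rule cSUP_upper)
    moreover have "h (S \<union> S\<^sub>0) = h S + h S\<^sub>0"
      unfolding h_def using S S\<^sub>0 by (intro sum.union_disjoint) (auto simp: \<F>_def)
    ultimately show "(\<Sum>u\<in>S. (a \<bullet> e u)\<^sup>2) \<le> \<epsilon>"
      using S\<^sub>0(2) by (simp add: h_def)
  qed (use S\<^sub>0 in \<open>auto simp: \<F>_def\<close>)
qed

section \<open>Singular vectors of compact operators\<close>

lemma bounded_linear_compact_operator:
  assumes "compact_operator K"
  shows "bounded_linear K"
proof -
  have lin: "linear K"
    using assms by (simp add: compact_operator_def)
  have "bounded (K ` cball 0 1)"
    using assms compact_imp_bounded bounded_subset closure_subset bounded_cball
    unfolding compact_operator_def by metis
  then obtain B where B: "\<And>x. norm x \<le> 1 \<Longrightarrow> norm (K x) \<le> B"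
    unfolding bounded_iff by (metis imageI mem_cball_0)
  show ?thesis
  proof (rule bounded_linear_intro)
    show "K (x + y) = K x + K y" for x y
      by (rule linear_add[OF lin])
    show "K (r *\<^sub>R x) = r *\<^sub>R K x" for r x
      by (rule linear_scale[OF lin])
    show "norm (K x) \<le> norm x * B" for x
    proof (cases "x = 0")
      case False
      with B[of "x /\<^sub>R norm x"] show ?thesis
        by (simp add: linear_scale[OF lin] field_simps)
    qed (simp add: linear_0[OF lin])
  qed
qed

text \<open>
  The singular value is not a separate parameter: it is \<open>norm (K u)\<close>, and the corresponding left
  singular vector is \<open>K u /\<^sub>R norm (K u)\<close>.
\<close>
definition singular_vector :: "('a::real_inner \<Rightarrow> 'b::real_inner) \<Rightarrow> 'a \<Rightarrow> bool" where
  "singular_vector K u \<longleftrightarrow> norm u = 1 \<and> K u \<noteq> 0 \<and> adjoint K (K u) = (norm (K u))\<^sup>2 *\<^sub>R u"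

text \<open>
  The supremum \<open>\<nu>\<close> of \<open>norm (K x)\<close> over the unit ball of \<open>W\<close> is attained, and a maximiser is a
  singular vector with singular value \<open>\<nu>\<close>. Indeed, for \<open>x\<close> in this ball the quantity
  \<open>norm (\<nu>\<^sup>2 x - K* K x)\<^sup>2\<close> is bounded by a multiple of \<open>\<nu>\<^sup>2 - norm (K x)\<^sup>2\<close>, so it tends to zero
  along a maximising sequence. By compactness \<open>K\<close>, and hence \<open>K* K\<close>, maps a subsequence to a
  convergent one, and therefore the subsequence itself converges.
\<close>
lemma singular_vector_exists:
  fixes K :: "'a::{real_inner, complete_space} \<Rightarrow> 'b::real_inner"
  assumes K: "compact_operator K"
    and W: "subspace W" "closed W" "\<And>x. x \<in> W \<Longrightarrow> adjoint K (K x) \<in> W"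
    and x0: "x0 \<in> W" "K x0 \<noteq> 0"
  shows "\<exists>u\<in>W. singular_vector K u"
proof -
  have blK: "bounded_linear K"
    by (rule bounded_linear_compact_operator[OF K])
  interpret K: bounded_linear K
    by (rule blK)
  interpret K': bounded_linear "adjoint K"
    by (rule bounded_linear_adjoint[OF blK])
  note adj = inner_adjoint[OF blK]
  define D where "D = {x\<in>W. norm x \<le> 1}"
  define \<nu> where "\<nu> = (SUP x\<in>D. norm (K x))"
  obtain B where B: "0 \<le> B" "\<And>x. norm (K x) \<le> norm x * B"
    using K.nonneg_bounded by blast
  have bdd: "bdd_above ((\<lambda>x. norm (K x)) ` D)"
  proof (rule bdd_aboveI2)
    fix x assume "x \<in> D"
    then have "norm x * B \<le> 1 * B"
      using B(1) by (intro mult_right_mono) (auto simp: D_def)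
    with B(2)[of x] show "norm (K x) \<le> B"
      by simp
  qed
  have D0: "0 \<in> D"
    using W(1) by (simp add: D_def subspace_0)
  have K_le: "norm (K x) \<le> \<nu> * norm x" if x: "x \<in> W" for x
  proof (cases "x = 0")
    case False
    have "x /\<^sub>R norm x \<in> D"
      using x W(1) False by (simp add: D_def subspace_scale)
    then have "norm (K (x /\<^sub>R norm x)) \<le> \<nu>"
      unfolding \<nu>_def using bdd by (rule cSUP_upper)
    then show ?thesis
      using False by (simp add: K.scaleR field_simps)
  qed (simp add: K.zero)
  have \<nu>: "\<nu> > 0"
  proof (rule ccontr)
    assume "\<not> \<nu> > 0"
    then have "\<nu> * norm x0 \<le> 0"
      by (simp add: mult_nonpos_nonneg)
    with K_le[OF x0(1)] have "norm (K x0) \<le> 0"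
      by (rule order_trans)
    with x0(2) show False
      by simp
  qed
  have "\<exists>x\<in>D. \<nu> - inverse (real (Suc n)) < norm (K x)" for n
  proof -
    have "\<nu> - inverse (real (Suc n)) < \<nu>"
      by simp
    then show ?thesis
      using less_cSUP_iff[OF _ bdd] D0 unfolding \<nu>_def by blast
  qed
  then obtain X where X: "\<And>n. X n \<in> D" "\<And>n. \<nu> - inverse (real (Suc n)) < norm (K (X n))"
    by metis
  have XW: "X n \<in> W" and Xn: "norm (X n) \<le> 1" for n
    using X(1)[of n] by (auto simp: D_def)
  have K_lim: "(\<lambda>n. norm (K (X n))) \<longlonglongrightarrow> \<nu>"
  proof (rule tendsto_sandwich)
    show "(\<lambda>n. \<nu> - inverse (real (Suc n))) \<longlonglongrightarrow> \<nu>"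
      using tendsto_diff[OF tendsto_const LIMSEQ_inverse_real_of_nat, of \<nu>] by simp
    have "norm (K (X n)) \<le> \<nu>" for n
      unfolding \<nu>_def using X(1) bdd by (rule cSUP_upper)
    then show "\<forall>\<^sub>F n in sequentially. norm (K (X n)) \<le> \<nu>"
      by simp
  qed (use X(2) in \<open>auto intro: always_eventually less_imp_le\<close>)
  define A where "A x = adjoint K (K x)" for x
  have defect: "(norm (\<nu>\<^sup>2 *\<^sub>R x - A x))\<^sup>2 \<le> 2 * \<nu>\<^sup>2 * (\<nu>\<^sup>2 - (norm (K x))\<^sup>2)"
    if x: "x \<in> W" "norm x \<le> 1" for x
  proof -
    have "(norm (A x))\<^sup>2 = K (A x) \<bullet> K x"
      by (simp add: power2_norm_eq_inner A_def adj)
    also have "\<dots> \<le> norm (K (A x)) * norm (K x)"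
      by (rule norm_cauchy_schwarz)
    also have "\<dots> \<le> (\<nu> * norm (A x)) * (\<nu> * norm x)"
      using W(3)[OF x(1)] x(1) \<nu> by (intro mult_mono K_le) (auto simp: A_def)
    also have "\<dots> \<le> (\<nu> * norm (A x)) * (\<nu> * 1)"
      using x(2) \<nu> by (intro mult_left_mono) auto
    finally have "norm (A x) * norm (A x) \<le> \<nu>\<^sup>2 * norm (A x)"
      by (simp add: power2_eq_square mult_ac)
    then have Ax: "norm (A x) \<le> \<nu>\<^sup>2"
      by (metis mult_right_le_imp_le norm_ge_zero order_le_less zero_le_power2)
    have "(norm (\<nu>\<^sup>2 *\<^sub>R x - A x))\<^sup>2 = \<nu>\<^sup>2 * \<nu>\<^sup>2 * (norm x)\<^sup>2 - 2 * \<nu>\<^sup>2 * (norm (K x))\<^sup>2 + (norm (A x))\<^sup>2"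
      unfolding norm_diff_square by (simp add: power2_norm_eq_inner A_def adj mult.assoc)
    moreover have "\<nu>\<^sup>2 * \<nu>\<^sup>2 * (norm x)\<^sup>2 \<le> \<nu>\<^sup>2 * \<nu>\<^sup>2 * 1"
      using x(2) by (intro mult_left_mono) (simp_all add: power_le_one)
    moreover have "(norm (A x))\<^sup>2 \<le> \<nu>\<^sup>2 * \<nu>\<^sup>2"
      using power_mono[OF Ax, of 2] by (simp flip: power2_eq_square)
    ultimately show ?thesis
      by (simp add: right_diff_distrib mult.assoc)
  qed
  have defect_lim: "(\<lambda>n. \<nu>\<^sup>2 *\<^sub>R X n - A (X n)) \<longlonglongrightarrow> 0"
  proof -
    have "(\<lambda>n. 2 * \<nu>\<^sup>2 * (\<nu>\<^sup>2 - (norm (K (X n)))\<^sup>2)) \<longlonglongrightarrow> 2 * \<nu>\<^sup>2 * (\<nu>\<^sup>2 - \<nu>\<^sup>2)"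
      by (intro tendsto_intros K_lim)
    then have upper: "(\<lambda>n. 2 * \<nu>\<^sup>2 * (\<nu>\<^sup>2 - (norm (K (X n)))\<^sup>2)) \<longlonglongrightarrow> 0"
      by simp
    have "(\<lambda>n. (norm (\<nu>\<^sup>2 *\<^sub>R X n - A (X n)))\<^sup>2) \<longlonglongrightarrow> 0"
      by (rule tendsto_sandwich[OF _ _ tendsto_const upper])
        (auto intro!: always_eventually defect[OF XW Xn])
    then have "(\<lambda>n. sqrt ((norm (\<nu>\<^sup>2 *\<^sub>R X n - A (X n)))\<^sup>2)) \<longlonglongrightarrow> sqrt 0"
      by (rule tendsto_real_sqrt)
    then show ?thesis
      by (simp add: tendsto_norm_zero_iff)
  qed
  have "compact (closure (K ` cball 0 1))"
    using K by (simp add: compact_operator_def)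
  moreover have "\<forall>n. K (X n) \<in> closure (K ` cball 0 1)"
    using Xn closure_subset by fastforce
  ultimately obtain l r where r: "strict_mono (r :: nat \<Rightarrow> nat)" "((\<lambda>n. K (X n)) \<circ> r) \<longlonglongrightarrow> l"
    unfolding compact_def by meson
  define x where "x = (1 / \<nu>\<^sup>2) *\<^sub>R adjoint K l"
  have Xr: "(\<lambda>n. X (r n)) \<longlonglongrightarrow> x"
  proof -
    have "(\<lambda>n. A (X (r n))) \<longlonglongrightarrow> adjoint K l"
      unfolding A_def using r(2) by (intro K'.tendsto) (simp add: o_def)
    from tendsto_add[OF this LIMSEQ_subseq_LIMSEQ[OF defect_lim r(1)]]
    have "(\<lambda>n. \<nu>\<^sup>2 *\<^sub>R X (r n)) \<longlonglongrightarrow> adjoint K l"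
      by (simp add: o_def)
    from tendsto_scaleR[OF tendsto_const this, of "1 / \<nu>\<^sup>2"] show ?thesis
      using \<nu> by (simp add: x_def)
  qed
  have xW: "x \<in> W"
    using W(2) XW Xr by (rule closed_sequentially)
  have Kx: "norm (K x) = \<nu>"
  proof (rule LIMSEQ_unique)
    show "(\<lambda>n. norm (K (X (r n)))) \<longlonglongrightarrow> norm (K x)"
      by (intro tendsto_norm K.tendsto Xr)
    show "(\<lambda>n. norm (K (X (r n)))) \<longlonglongrightarrow> \<nu>"
      using LIMSEQ_subseq_LIMSEQ[OF K_lim r(1)] by (simp add: o_def)
  qed
  have "norm x \<le> 1"
    using Xn by (intro LIMSEQ_le_const2[OF tendsto_norm[OF Xr]]) auto
  moreover have "1 \<le> norm x"
    using K_le[OF xW] Kx \<nu> by simp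
  ultimately have nx: "norm x = 1"
    by simp
  have "A x = \<nu>\<^sup>2 *\<^sub>R x"
    using defect[OF xW] nx Kx by simp
  then have "singular_vector K x"
    using nx Kx \<nu> by (auto simp: singular_vector_def A_def)
  with xW show ?thesis
    by blast
qed

lemma singular_vector_in_orthogonal_comp:
  fixes K :: "'a::{real_inner, complete_space} \<Rightarrow> 'b::real_inner"
  assumes K: "bounded_linear K" and u: "singular_vector K u"
  shows "u \<in> orthogonal_comp (null_space K)"
proof -
  have "n \<bullet> u = 0" if "K n = 0" for n
  proof -
    have "(norm (K u))\<^sup>2 * (n \<bullet> u) = n \<bullet> adjoint K (K u)"
      using u by (simp add: singular_vector_def)
    also have "\<dots> = 0"
      by (simp add: inner_adjoint[OF K, symmetric] that)
    finally show ?thesis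
      using u by (simp add: singular_vector_def)
  qed
  then show ?thesis
    by (auto simp: orthogonal_comp_def null_space_def orthogonal_def)
qed

lemma orthonormal_image_singular_vectors:
  fixes K :: "'a::{real_inner, complete_space} \<Rightarrow> 'b::real_inner"
  assumes K: "bounded_linear K" and M: "orthonormal (\<lambda>u. u) M" "\<And>u. u \<in> M \<Longrightarrow> singular_vector K u"
  shows "orthonormal (\<lambda>u. K u /\<^sub>R norm (K u)) M"
  unfolding orthonormal_def
proof (intro ballI)
  fix u w assume uw: "u \<in> M" "w \<in> M"
  have "K u \<bullet> K w = (norm (K w))\<^sup>2 * (u \<bullet> w)"
    using M(2)[OF uw(2)] by (simp add: inner_adjoint[OF K] singular_vector_def)
  also have "u \<bullet> w = of_bool (u = w)"
    using M(1) uw unfolding orthonormal_def by blast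
  finally show "(K u /\<^sub>R norm (K u)) \<bullet> (K w /\<^sub>R norm (K w)) = of_bool (u = w)"
    using M(2)[OF uw(1)] by (auto simp: singular_vector_def power2_eq_square field_simps)
qed

text \<open>
  A maximal orthonormal set of singular vectors. Its orthogonal complement \<open>W\<close> is invariant under
  \<open>K* K\<close>, so if \<open>K\<close> did not vanish on \<open>W\<close>, then \<open>W\<close> would contain another singular vector.
\<close>
lemma singular_basis_exists:
  fixes K :: "'a::{real_inner, complete_space} \<Rightarrow> 'b::real_inner"
  assumes K: "compact_operator K"
  shows "\<exists>M. orthonormal (\<lambda>u. u) M \<and> (\<forall>u\<in>M. singular_vector K u) \<and>
    orthogonal_comp (null_space K) \<subseteq> closure (span M)"
proof -
  have blK: "bounded_linear K"
    by (rule bounded_linear_compact_operator[OF K])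
  note adj = inner_adjoint[OF blK]
  interpret K: bounded_linear K
    by (rule blK)
  define \<A> where "\<A> = {M. orthonormal (\<lambda>u. u) M \<and> (\<forall>u\<in>M. singular_vector K u)}"
  have "\<exists>M\<in>\<A>. \<forall>X\<in>\<A>. M \<subseteq> X \<longrightarrow> X = M"
  proof (rule subset_Zorn')
    fix C assume C: "subset.chain \<A> C"
    have "u \<bullet> w = of_bool (u = w)" if uw: "u \<in> \<Union>C" "w \<in> \<Union>C" for u w
    proof -
      obtain X Y where XY: "u \<in> X" "X \<in> C" "w \<in> Y" "Y \<in> C"
        using uw by blast
      then have "X \<subseteq> Y \<or> Y \<subseteq> X"
        using C unfolding subset_chain_def by blast
      then have "\<exists>Z\<in>C. u \<in> Z \<and> w \<in> Z"
        using XY by blast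
      then show ?thesis
        using C unfolding subset_chain_def \<A>_def orthonormal_def by blast
    qed
    moreover have "singular_vector K u" if "u \<in> \<Union>C" for u
      using that C unfolding subset_chain_def \<A>_def by blast
    ultimately show "\<Union>C \<in> \<A>"
      unfolding \<A>_def orthonormal_def by blast
  qed
  then obtain M where MA: "M \<in> \<A>" and max: "\<And>X. X \<in> \<A> \<Longrightarrow> M \<subseteq> X \<Longrightarrow> X = M"
    by metis
  have M: "orthonormal (\<lambda>u. u) M" "\<And>u. u \<in> M \<Longrightarrow> singular_vector K u"
    using MA unfolding \<A>_def by simp_all
  define W where "W = {x. \<forall>u\<in>M. x \<bullet> u = 0}"
  have W_null: "K x = 0" if "x \<in> W" for x
  proof (rule ccontr)
    assume "K x \<noteq> 0"
    have "W = (\<Inter>u\<in>M. {x. x \<bullet> u = 0})"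
      by (auto simp: W_def)
    then have "closed W"
      by (auto intro!: closed_INT closed_Collect_eq continuous_intros)
    moreover have "subspace W"
      by (auto simp: W_def subspace_def inner_add_left)
    moreover have "adjoint K (K x) \<in> W" if "x \<in> W" for x
    proof -
      have "adjoint K (K x) \<bullet> u = 0" if u: "u \<in> M" for u
      proof -
        have "adjoint K (K x) \<bullet> u = x \<bullet> adjoint K (K u)"
          by (metis adj inner_commute)
        also have "\<dots> = (norm (K u))\<^sup>2 * (x \<bullet> u)"
          using M(2)[OF u] by (simp add: singular_vector_def)
        finally show ?thesis
          using \<open>x \<in> W\<close> u by (simp add: W_def)
      qed
      then show ?thesis
        by (simp add: W_def)
    qed
    ultimately obtain u where u: "u \<in> W" "singular_vector K u"
      using singular_vector_exists[OF K] \<open>x \<in> W\<close> \<open>K x \<noteq> 0\<close> by blast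
    have uu: "u \<bullet> u = 1"
      using u(2) by (simp add: singular_vector_def norm_eq_1)
    then have "u \<notin> M"
      using u(1) unfolding W_def by force
    have "insert u M \<in> \<A>"
      using M u uu \<open>u \<notin> M\<close> unfolding \<A>_def orthonormal_def W_def
      by (auto simp: inner_commute)
    with max \<open>u \<notin> M\<close> show False
      by blast
  qed
  have "v \<in> closure (span M)" if v: "v \<in> orthogonal_comp (null_space K)" for v
  proof -
    let ?N = "orthogonal_comp (null_space K)"
    obtain p where p: "p \<in> closure (span M)" "\<forall>x\<in>span M. (v - p) \<bullet> x = 0"
      using projection_exists[OF subspace_span] by blast
    have "v - p \<in> W"
      using p(2) by (auto simp: W_def span_base)
    then have "v - p \<in> null_space K"
      using W_null by (simp add: null_space_def)
    moreover have "v - p \<in> ?N"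
    proof -
      have "M \<subseteq> ?N"
        using singular_vector_in_orthogonal_comp[OF blK] M(2) by blast
      then have "span M \<subseteq> ?N"
        by (intro span_minimal subspace_orthogonal_comp)
      moreover have "closed ?N"
      proof -
        have "?N = (\<Inter>n\<in>null_space K. {x. n \<bullet> x = 0})"
          by (auto simp: orthogonal_comp_def orthogonal_def)
        then show ?thesis
          by (auto intro!: closed_INT closed_Collect_eq continuous_intros)
      qed
      ultimately have "closure (span M) \<subseteq> ?N"
        by (rule closure_minimal)
      with p(1) v show ?thesis
        by (intro subspace_diff subspace_orthogonal_comp) auto
    qed
    ultimately have "v - p = 0"
      by (auto simp: orthogonal_comp_def orthogonal_def)
    with p(1) show ?thesis
      by simp
  qed
  with M show ?thesis
    by blast
qed

text \<open>Adding elements of the null space yields other solutions, none of which has a smaller norm.\<close>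
lemma minimum_norm_solution_orthogonal:
  assumes K: "linear K" and f: "is_arg_min norm (\<lambda>g. K g = y) f"
  shows "f \<in> orthogonal_comp (null_space K)"
proof -
  have "f \<bullet> n = 0" if n: "K n = 0" for n
  proof (rule inner_eq_0_if_norm_minimal)
    fix t
    have "K (f + t *\<^sub>R n) = y"
      using f n by (simp add: is_arg_min_def linear_add[OF K] linear_scale[OF K])
    then show "norm f \<le> norm (f + t *\<^sub>R n)"
      using f by (auto simp: is_arg_min_def not_less)
  qed
  then show ?thesis
    by (auto simp: orthogonal_comp_def null_space_def orthogonal_def inner_commute)
qed

section \<open>The damped oscillator\<close>

text \<open>
  The equation satisfied by the coefficients of the error, up to an additive constant. It is singular
  at \<open>0\<close>, and \<open>p'\<close> is not assumed to be continuous there.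
\<close>
locale damped_oscillator =
  fixes p p' p'' :: "real \<Rightarrow> real" and c l :: real
  assumes c: "c > 0" and l: "l > 0"
    and p_deriv: "\<And>t. t \<ge> 0 \<Longrightarrow> (p has_real_derivative p' t) (at t within {0..})"
    and p'_deriv: "\<And>t. t > 0 \<Longrightarrow> (p' has_real_derivative p'' t) (at t)"
    and p'_0: "p' 0 = 0"
    and ode: "\<And>t. t > 0 \<Longrightarrow> p'' t + (c / t) * p' t + l\<^sup>2 * p t = 0"
begin

definition energy :: "real \<Rightarrow> real" where
  "energy t = ((p' t)\<^sup>2 + l\<^sup>2 * (p t)\<^sup>2) / 2"

lemma p_deriv_at: "(p has_real_derivative p' t) (at t)" if "t > 0"
proof -
  have "t \<in> interior {0..}"
    using that by simp
  then show ?thesis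
    using p_deriv[of t] that at_within_interior[of t "{0..}"] by simp
qed

lemma p''_eq: "t > 0 \<Longrightarrow> p'' t = - (c / t) * p' t - l\<^sup>2 * p t"
  using ode[of t] by simp

lemma energy_deriv: "(energy has_real_derivative - (c / t) * (p' t)\<^sup>2) (at t)" if t: "t > 0"
  unfolding energy_def
  by (rule derivative_eq_intros p_deriv_at[OF t] p'_deriv[OF t] refl)+
    (use t in \<open>simp_all add: p''_eq[OF t] power2_eq_square field_simps\<close>)

lemma energy_antimono: "energy b \<le> energy a" if "0 < a" "a \<le> b"
proof (rule DERIV_nonpos_imp_nonincreasing[OF \<open>a \<le> b\<close>])
  fix x assume "a \<le> x" "x \<le> b"
  then show "\<exists>y. DERIV energy x :> y \<and> y \<le> 0"
    using energy_deriv[of x] c \<open>0 < a\<close> by (intro exI[of _ "- (c / x) * (p' x)\<^sup>2"]) auto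
qed

lemma mean_value: "\<exists>\<xi>. 0 < \<xi> \<and> \<xi> < t \<and> p t - p 0 = t * p' \<xi>" if t: "t > 0"
proof -
  have "continuous_on {0..t} p"
    using p_deriv by (meson DERIV_continuous_on atLeastAtMost_iff atLeast_iff
        continuous_on_subset subsetI)
  moreover have "(p has_derivative (*) (p' x)) (at x)" if "0 < x" for x
    using p_deriv_at[OF that] by (simp add: has_field_derivative_def)
  ultimately obtain \<xi> where "0 < \<xi>" "\<xi> < t" "p t - p 0 = p' \<xi> * (t - 0)"
    using mvt[OF t, of p "\<lambda>x. (*) (p' x)"] by blast
  then show ?thesis
    by (auto simp: mult.commute)
qed

text \<open>
  Since \<open>p'\<close> may be discontinuous at \<open>0\<close>, one cannot simply let \<open>a\<close> tend to \<open>0\<close> in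
  \<open>energy t \<le> energy a\<close>. However, the difference quotients of \<open>p\<close> at \<open>0\<close> tend to \<open>p' 0 = 0\<close> and
  are values of \<open>p'\<close> at intermediate points, so \<open>p'\<close> tends to \<open>0\<close> along some sequence \<open>\<xi>\<close> of
  positive times that tends to \<open>0\<close>. By monotonicity of the energy, one such sequence is enough.
\<close>
lemma energy_le_initial: "energy t \<le> l\<^sup>2 * (p 0)\<^sup>2 / 2" if t: "t > 0"
proof -
  have h: "\<exists>\<xi>. 0 < \<xi> \<and> \<xi> < inverse (real (Suc n)) \<and>
      p (inverse (real (Suc n))) - p 0 = inverse (real (Suc n)) * p' \<xi>" for n
    by (rule mean_value) simp
  then obtain \<xi> where \<xi>: "\<And>n. 0 < \<xi> n" "\<And>n. \<xi> n < inverse (real (Suc n))"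
    "\<And>n. p (inverse (real (Suc n))) - p 0 = inverse (real (Suc n)) * p' (\<xi> n)"
    by metis
  have \<xi>_lim: "\<xi> \<longlonglongrightarrow> 0"
    using \<xi>(1,2) by (intro tendsto_sandwich[OF _ _ tendsto_const LIMSEQ_inverse_real_of_nat])
      (simp_all add: less_imp_le del: of_nat_Suc)
  have "((\<lambda>x. (p x - p 0) / (x - 0)) \<longlongrightarrow> 0) (at 0 within {0..})"
    using p_deriv[of 0] p'_0 by (simp add: has_field_derivative_iff)
  moreover have "filterlim (\<lambda>n. inverse (real (Suc n))) (at 0 within {0..}) sequentially"
    unfolding filterlim_at using LIMSEQ_inverse_real_of_nat by auto
  ultimately have "(\<lambda>n. (p (inverse (real (Suc n))) - p 0) / (inverse (real (Suc n)) - 0)) \<longlonglongrightarrow> 0"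
    by (rule filterlim_compose)
  then have p'_lim: "(\<lambda>n. p' (\<xi> n)) \<longlonglongrightarrow> 0"
    unfolding \<xi>(3) by (simp del: of_nat_Suc)
  have "filterlim \<xi> (at 0 within {0..}) sequentially"
    unfolding filterlim_at using \<xi>_lim \<xi>(1) by (auto intro: always_eventually less_imp_le simp: less_imp_neq[symmetric])
  moreover have "(p \<longlongrightarrow> p 0) (at 0 within {0..})"
    using DERIV_continuous[OF p_deriv[of 0]] by (simp add: continuous_within)
  ultimately have "(\<lambda>n. p (\<xi> n)) \<longlonglongrightarrow> p 0"
    by (rule filterlim_compose[rotated])
  then have "(\<lambda>n. energy (\<xi> n)) \<longlonglongrightarrow> (0\<^sup>2 + l\<^sup>2 * (p 0)\<^sup>2) / 2"
    unfolding energy_def by (intro tendsto_intros p'_lim) auto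
  moreover have "\<forall>\<^sub>F n in sequentially. energy t \<le> energy (\<xi> n)"
    using order_tendstoD(2)[OF \<xi>_lim t] by eventually_elim (use \<xi>(1) energy_antimono in auto)
  ultimately show ?thesis
    using tendsto_lowerbound by force
qed

lemma abs_p_le: "\<bar>p t\<bar> \<le> \<bar>p 0\<bar>" if "t > 0"
proof -
  have "l\<^sup>2 * (p t)\<^sup>2 \<le> l\<^sup>2 * (p 0)\<^sup>2"
    using energy_le_initial[OF that] zero_le_power2[of "p' t"]
    unfolding energy_def by argo
  then have "(p t)\<^sup>2 \<le> (p 0)\<^sup>2"
    using l by simp
  then show ?thesis
    by (simp add: abs_le_square_iff)
qed

lemma abs_p'_le: "\<bar>p' t\<bar> \<le> l * \<bar>p 0\<bar>" if "t > 0"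
proof -
  have "(p' t)\<^sup>2 \<le> (l * p 0)\<^sup>2"
    using energy_le_initial[OF that] zero_le_power2[of "l * p t"]
    unfolding energy_def power_mult_distrib by argo
  then have "\<bar>p' t\<bar> \<le> \<bar>l * p 0\<bar>"
    by (simp add: abs_le_square_iff)
  then show ?thesis
    using l by (simp add: abs_mult)
qed

lemma abs_p_diff_le: "\<bar>p t - p 0\<bar> \<le> l * t * \<bar>p 0\<bar>" if t: "t > 0"
proof -
  obtain \<xi> where \<xi>: "0 < \<xi>" "p t - p 0 = t * p' \<xi>"
    using mean_value[OF t] by blast
  then show ?thesis
    using mult_left_mono[OF abs_p'_le[OF \<xi>(1)], of t] t by (simp add: abs_mult mult_ac)
qed

text \<open>
  The friction damps the energy only through \<open>p'\<close>. The derivative of \<open>p p'\<close> contains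
  \<open>p'\<^sup>2 - l\<^sup>2 p\<^sup>2\<close>, so a correction of the energy by \<open>c/(2t) p p'\<close> distributes the damping evenly over
  both parts: up to terms of order \<open>t\<^sup>-\<^sup>2\<close> the corrected energy \<open>V\<close> satisfies \<open>V' = -(c/t) V\<close>. Giving
  up half of this rate absorbs those terms for large \<open>t\<close>, whence \<open>V\<close> decays at least like
  \<open>t\<close> to the power \<open>-c/2\<close>. The bound \<open>c \<le> l * t0\<close> keeps \<open>V\<close> between one half and
  three halves of the energy, the bound by \<open>2 * (c + 1)\<close> makes the terms of order \<open>t\<^sup>-\<^sup>2\<close> small
  enough, and the constant \<open>3\<close> is the quotient of these two fractions.
\<close>
lemma square_decay:
  assumes t0: "t0 > 0" "c \<le> l * t0" "2 * (c + 1) \<le> l * t0" and t: "t0 \<le> t"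
  shows "(p t)\<^sup>2 \<le> 3 * (t0 / t) powr (c / 2) * (p 0)\<^sup>2"
proof -
  define V where "V x = energy x + c / (2 * x) * (p x * p' x)" for x
  have pp': "\<bar>p x * p' x\<bar> \<le> energy x / l" for x
  proof -
    have "0 \<le> (\<bar>p' x\<bar> - l * \<bar>p x\<bar>)\<^sup>2"
      by simp
    then have "l * \<bar>p x * p' x\<bar> \<le> energy x"
      by (simp add: energy_def power2_diff power_mult_distrib abs_mult field_simps)
    then show ?thesis
      using l by (simp add: field_simps)
  qed
  have E0: "energy x \<ge> 0" for x
    by (simp add: energy_def)
  have V_near: "\<bar>V x - energy x\<bar> \<le> energy x / 2" if x: "t0 \<le> x" for x
  proof -
    have x0: "x > 0"
      using x t0(1) by linarith
    have "c \<le> l * x"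
      using t0(2) mult_left_mono[OF x, of l] l by linarith
    then have "c / (2 * x) / l \<le> 1 / 2"
      using x0 l by (simp add: field_simps)
    then have "(c / (2 * x) / l) * energy x \<le> (1 / 2) * energy x"
      using E0 by (rule mult_right_mono)
    moreover have "c / (2 * x) * \<bar>p x * p' x\<bar> \<le> c / (2 * x) * (energy x / l)"
      using c x0 by (intro mult_left_mono pp') auto
    moreover have "c / (2 * x) * (energy x / l) = (c / (2 * x) / l) * energy x"
      by simp
    ultimately have "c / (2 * x) * \<bar>p x * p' x\<bar> \<le> energy x / 2"
      by linarith
    then show ?thesis
      using c x0 by (simp add: V_def abs_mult)
  qed
  have V_deriv: "\<exists>D. (V has_real_derivative D) (at x) \<and> D \<le> - (c / (2 * x)) * V x" if x: "t0 \<le> x" for x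
  proof -
    have x0: "x > 0"
      using x t0(1) by linarith
    let ?D = "- (c / x) * energy x - c * (c + 1) / (2 * x\<^sup>2) * (p x * p' x)"
    have "((\<lambda>x. c / (2 * x)) has_real_derivative - (c / (2 * x\<^sup>2))) (at x)"
      by (rule derivative_eq_intros refl)+ (use x0 in \<open>simp_all add: power2_eq_square field_simps\<close>)
    from DERIV_add[OF energy_deriv[OF x0] DERIV_mult[OF this
        DERIV_mult[OF p_deriv_at[OF x0] p'_deriv[OF x0]]]]
    have "(V has_real_derivative - (c / x) * (p' x)\<^sup>2 + (- (c / (2 * x\<^sup>2)) * (p x * p' x)
        + (p' x * p' x + p'' x * p x) * (c / (2 * x)))) (at x)"
      unfolding V_def .
    moreover have "- (c / x) * (p' x)\<^sup>2 + (- (c / (2 * x\<^sup>2)) * (p x * p' x)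
        + (p' x * p' x + p'' x * p x) * (c / (2 * x))) = ?D"
      using x0 by (simp add: p''_eq[OF x0] energy_def power2_eq_square field_simps)
    ultimately have "(V has_real_derivative ?D) (at x)"
      by simp
    moreover have "?D \<le> - (c / (2 * x)) * V x"
    proof -
      have "2 * (c + 1) \<le> l * x"
        using t0(3) mult_left_mono[OF x, of l] l by linarith
      then have "(c + 1) / (x * l) \<le> 1 / 2"
        using x0 l by (simp add: field_simps)
      then have "((c + 1) / (x * l)) * energy x \<le> (1 / 2) * energy x"
        using E0 by (rule mult_right_mono)
      moreover have "(c + 1) / x * \<bar>p x * p' x\<bar> \<le> (c + 1) / x * (energy x / l)"
        using c x0 by (intro mult_left_mono pp') auto
      moreover have "- ((c + 1) / x * (p x * p' x)) \<le> (c + 1) / x * \<bar>p x * p' x\<bar>"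
        using mult_left_mono[OF abs_ge_minus_self, of "(c + 1) / x" "p x * p' x"] c x0 by simp
      moreover have "(c + 1) / x * (energy x / l) = ((c + 1) / (x * l)) * energy x"
        by simp
      ultimately have "- ((c + 1) / x * (p x * p' x)) \<le> energy x / 2"
        by argo
      moreover have "V x \<le> energy x * (3 / 2)"
        using V_near[OF x] by linarith
      ultimately have "- (2 * energy x) - (c + 1) / x * (p x * p' x) \<le> - V x"
        by linarith
      from mult_left_mono[OF this, of "c / (2 * x)"] show ?thesis
        using c x0 by (simp add: power2_eq_square field_simps)
    qed
    ultimately show ?thesis
      by blast
  qed
  have t_pos: "t > 0"
    using t t0(1) by linarith
  have "t powr (c / 2) * V t \<le> t0 powr (c / 2) * V t0"
  proof (rule DERIV_nonpos_imp_nonincreasing[OF t])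
    fix x assume x: "t0 \<le> x" "x \<le> t"
    then have x0: "x > 0"
      using t0(1) by linarith
    obtain D where D: "(V has_real_derivative D) (at x)" "D \<le> - (c / (2 * x)) * V x"
      using V_deriv[OF x(1)] by blast
    have powr_pred: "x powr (c / 2 - 1) = x powr (c / 2) / x"
      using x0 by (simp add: powr_diff)
    have "((\<lambda>x. x powr (c / 2) * V x) has_real_derivative x powr (c / 2) * (c / (2 * x) * V x + D)) (at x)"
      by (rule DERIV_cong[OF DERIV_mult[OF has_real_derivative_powr[OF x0] D(1)]])
        (use x0 in \<open>simp add: powr_pred distrib_left\<close>)
    moreover have "x powr (c / 2) * (c / (2 * x) * V x + D) \<le> 0"
      using D(2) by (intro mult_nonneg_nonpos) auto
    ultimately show "\<exists>y. DERIV (\<lambda>x. x powr (c / 2) * V x) x :> y \<and> y \<le> 0"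
      by blast
  qed
  then have "V t \<le> (t0 / t) powr (c / 2) * V t0"
    using t_pos t0(1) by (simp add: powr_divide field_simps)
  also have "V t0 \<le> 3 / 2 * (l\<^sup>2 * (p 0)\<^sup>2 / 2)"
    using V_near[of t0] energy_le_initial[OF t0(1)] by linarith
  finally have "V t \<le> (t0 / t) powr (c / 2) * (3 / 2 * (l\<^sup>2 * (p 0)\<^sup>2 / 2))"
    by (simp add: mult_left_mono)
  moreover have "l\<^sup>2 * (p t)\<^sup>2 / 4 \<le> V t"
  proof -
    have "energy t \<le> 2 * V t"
      using V_near[OF t] by linarith
    then show ?thesis
      using zero_le_power2[of "p' t"] unfolding energy_def by argo
  qed
  ultimately have "l\<^sup>2 * (p t)\<^sup>2 \<le> l\<^sup>2 * (3 * (t0 / t) powr (c / 2) * (p 0)\<^sup>2)"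
    by (simp add: algebra_simps)
  then show ?thesis
    using l by simp
qed

text \<open>
  The factor is \<open>p t / p 0\<close>, the value at \<open>t\<close> of the normalised solution. If \<open>p 0 = 0\<close>, then \<open>p\<close>
  vanishes and any number is a factor; the last hypothesis makes either \<open>1\<close> or \<open>0\<close> satisfy both
  bounds.
\<close>
lemma factor_exists:
  assumes t: "t > 0" and \<epsilon>: "(p t)\<^sup>2 \<le> \<epsilon> * (p 0)\<^sup>2" "\<epsilon> \<ge> 0" "\<epsilon> \<ge> 1 \<or> l * t \<ge> 1"
  shows "\<exists>\<psi>. p t = \<psi> * p 0 \<and> \<psi>\<^sup>2 \<le> \<epsilon> \<and> \<bar>1 - \<psi>\<bar> \<le> l * t"
proof (cases "p 0 = 0")
  case True
  then have "p t = 0"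
    using \<epsilon>(1) by simp
  then show ?thesis
    using True \<epsilon>(2,3) l t by (intro exI[of _ "of_bool (\<epsilon> \<ge> 1)"]) auto
next
  case False
  have "\<bar>1 - p t / p 0\<bar> * \<bar>p 0\<bar> = \<bar>p t - p 0\<bar>"
    using False by (simp add: abs_mult[symmetric] left_diff_distrib abs_minus_commute)
  also have "\<dots> \<le> l * t * \<bar>p 0\<bar>"
    by (rule abs_p_diff_le[OF t])
  finally have "\<bar>1 - p t / p 0\<bar> \<le> l * t"
    using False by (simp add: mult_le_cancel_right)
  then show ?thesis
    using False \<epsilon>(1) by (intro exI[of _ "p t / p 0"]) (simp add: power_divide divide_le_eq)
qed

lemma factor_bounded:
  assumes "t > 0"
  shows "\<exists>\<psi>. p t = \<psi> * p 0 \<and> \<psi>\<^sup>2 \<le> 1 \<and> \<bar>1 - \<psi>\<bar> \<le> l * t"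
  using factor_exists[OF assms, of 1] abs_p_le[OF assms] by (simp add: abs_le_square_iff)

end

text \<open>
  The time \<open>t\<^sub>1\<close> has to be the same for all solutions, because the solution will depend on the noisy
  data.
\<close>
lemma damped_oscillator_factor_decay:
  assumes "c > 0" "l > 0" "\<epsilon> > 0"
  shows "\<exists>t\<^sub>1. \<forall>p p' p'' t. damped_oscillator p p' p'' c l \<longrightarrow> t \<ge> t\<^sub>1 \<longrightarrow>
    (\<exists>\<psi>. p t = \<psi> * p 0 \<and> \<psi>\<^sup>2 \<le> \<epsilon> \<and> \<bar>1 - \<psi>\<bar> \<le> l * t)"
proof -
  \<comment> \<open>The least time allowed by the bound on the square; from then on \<open>l * t \<ge> 1\<close> as well.\<close>
  define t0 where "t0 = 2 * (c + 1) / l"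
  have t0: "t0 > 0" "c \<le> l * t0" "2 * (c + 1) \<le> l * t0"
    using assms by (simp_all add: t0_def)
  have "((\<lambda>t. 3 * (t0 / t) powr (c / 2)) \<longlongrightarrow> 3 * 0) at_top"
    using assms t0(1)
    by (intro tendsto_intros tendsto_zero_powrI[OF _ tendsto_const]
        tendsto_divide_0[OF tendsto_const] filterlim_at_top_imp_at_infinity filterlim_ident)
      (auto intro: eventually_mono[OF eventually_gt_at_top[of 0]])
  then have "\<forall>\<^sub>F t in at_top. 3 * (t0 / t) powr (c / 2) < \<epsilon>"
    using assms(3) by (intro order_tendstoD) auto
  then obtain t1 where t1: "\<And>t. t \<ge> t1 \<Longrightarrow> 3 * (t0 / t) powr (c / 2) < \<epsilon>"
    by (auto simp: eventually_at_top_linorder)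
  have "\<exists>\<psi>. p t = \<psi> * p 0 \<and> \<psi>\<^sup>2 \<le> \<epsilon> \<and> \<bar>1 - \<psi>\<bar> \<le> l * t"
    if osc: "damped_oscillator p p' p'' c l" and t: "t \<ge> max t0 t1" for p p' p'' t
  proof (rule damped_oscillator.factor_exists[OF osc])
    have "(p t)\<^sup>2 \<le> 3 * (t0 / t) powr (c / 2) * (p 0)\<^sup>2"
      using damped_oscillator.square_decay[OF osc t0] t by simp
    also have "\<dots> \<le> \<epsilon> * (p 0)\<^sup>2"
      using t1[of t] t by (intro mult_right_mono) auto
    finally show "(p t)\<^sup>2 \<le> \<epsilon> * (p 0)\<^sup>2" .
    have "l * t0 \<le> l * t"
      using assms t by (intro mult_left_mono) auto
    with t0(3) have "2 * (c + 1) \<le> l * t"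
      by (rule order_trans)
    then have "1 \<le> l * t"
      using assms(1) by argo
    then show "1 \<le> \<epsilon> \<or> 1 \<le> l * t" ..
  qed (use t t0(1) assms in auto)
  then show ?thesis
    by blast
qed

section \<open>Convergence of the dynamic solution\<close>

text \<open>
  The vector \<open>g\<close>, to be taken as the exact solution, splits the data as \<open>K g + (z - K g)\<close>. Taking the
  inner product of the evolution equation with \<open>u\<close> leaves an oscillator that is driven by a
  constant force; subtracting its equilibrium \<open>g \<bullet> u + q\<close> makes it homogeneous.
\<close>
lemma error_coefficient_oscillates:
  fixes K :: "'q::{real_inner, complete_space} \<Rightarrow> 'y::real_inner" and g :: 'q
  assumes K: "bounded_linear K" and s: "s > -1/2" and u: "singular_vector K u"
    and f: "dynamic_solution K s f0 z f"
  defines "q \<equiv> (z - K g) \<bullet> K u / (norm (K u))\<^sup>2"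
  shows "\<exists>p p' p''. damped_oscillator p p' p'' (1 + 2 * s) (norm (K u)) \<and>
    p 0 = (f0 - g) \<bullet> u - q \<and> (\<forall>t\<ge>0. (f t - g) \<bullet> u = p t + q)"
proof -
  note adj = inner_adjoint[OF K]
  obtain F F' F'' where F0: "F 0 = f0" "F' 0 = 0"
    and F': "\<And>t. t \<ge> 0 \<Longrightarrow> (F has_vector_derivative F' t) (at t within {0..})"
    and F'': "\<And>t. t > 0 \<Longrightarrow> (F' has_vector_derivative F'' t) (at t)"
    and ode: "\<And>t. t > 0 \<Longrightarrow>
      F'' t + ((1 + 2 * s) / t) *\<^sub>R F' t + adjoint K (K (F t)) = adjoint K z"
    and Ff: "\<And>t. t \<ge> 0 \<Longrightarrow> F t - f t \<in> null_space K"
    using f unfolding dynamic_solution_def ivp_solution_def by blast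
  define l where "l = norm (K u)"
  have l: "l > 0" and Ku: "adjoint K (K u) = l\<^sup>2 *\<^sub>R u"
    using u by (simp_all add: singular_vector_def l_def)
  have AK: "adjoint K (K x) \<bullet> u = l\<^sup>2 * (x \<bullet> u)" for x
    by (metis Ku adj inner_commute inner_scaleR_right)
  have Az: "adjoint K z \<bullet> u = l\<^sup>2 * (g \<bullet> u + q)"
  proof -
    have "adjoint K z \<bullet> u = z \<bullet> K u"
      by (metis adj inner_commute)
    also have "\<dots> = K g \<bullet> K u + (z - K g) \<bullet> K u"
      by (simp add: inner_diff_left)
    also have "K g \<bullet> K u = l\<^sup>2 * (g \<bullet> u)"
      by (simp add: adj Ku)
    also have "(z - K g) \<bullet> K u = l\<^sup>2 * q"
      using l by (simp add: q_def l_def)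
    finally show ?thesis
      by (simp add: distrib_left)
  qed
  define p where "p t = F t \<bullet> u - (g \<bullet> u + q)" for t
  have "damped_oscillator p (\<lambda>t. F' t \<bullet> u) (\<lambda>t. F'' t \<bullet> u) (1 + 2 * s) l"
  proof
    show "(p has_real_derivative F' t \<bullet> u) (at t within {0..})" if "t \<ge> 0" for t
      using bounded_linear.has_vector_derivative[OF bounded_linear_inner_left F'[OF that]]
      unfolding p_def has_real_derivative_iff_has_vector_derivative[symmetric]
      by (auto intro!: derivative_eq_intros)
    show "((\<lambda>t. F' t \<bullet> u) has_real_derivative F'' t \<bullet> u) (at t)" if "t > 0" for t
      using bounded_linear.has_vector_derivative[OF bounded_linear_inner_left F''[OF that]]
      by (simp add: has_real_derivative_iff_has_vector_derivative)
    show "F'' t \<bullet> u + (1 + 2 * s) / t * (F' t \<bullet> u) + l\<^sup>2 * p t = 0" if "t > 0" for t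
      using arg_cong[OF ode[OF that], of "\<lambda>x. x \<bullet> u"]
      by (simp add: inner_add_left AK Az p_def right_diff_distrib)
  qed (use s l F0 in auto)
  moreover have "p 0 = (f0 - g) \<bullet> u - q"
    by (simp add: p_def F0 inner_diff_left)
  moreover have "(f t - g) \<bullet> u = p t + q" if t: "t \<ge> 0" for t
  proof -
    have "(F t - f t) \<bullet> u = 0"
      using Ff[OF t] singular_vector_in_orthogonal_comp[OF K u]
      by (auto simp: orthogonal_comp_def orthogonal_def)
    then show ?thesis
      by (simp add: p_def inner_diff_left)
  qed
  ultimately show ?thesis
    unfolding l_def by blast
qed

text \<open>
  With the initial error \<open>a\<close> and the propagated noise \<open>q\<close> the coefficient is \<open>\<psi> a + (1 - \<psi>) q\<close>. As
  \<open>q\<close> contains the inverse of the singular value, the bound on \<open>1 - \<psi>\<close> turns the noise term into one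
  that does not deteriorate for small singular values.
\<close>
lemma error_coefficient_le:
  fixes K :: "'q::{real_inner, complete_space} \<Rightarrow> 'y::real_inner" and g :: 'q
  assumes K: "bounded_linear K" and s: "s > -1/2" and u: "singular_vector K u"
    and f: "dynamic_solution K s f0 z f" and t: "t \<ge> 0"
    and factor: "\<And>p p' p''. damped_oscillator p p' p'' (1 + 2 * s) (norm (K u)) \<Longrightarrow>
      \<exists>\<psi>. p t = \<psi> * p 0 \<and> \<psi>\<^sup>2 \<le> \<eta> \<and> \<bar>1 - \<psi>\<bar> \<le> norm (K u) * t"
  shows "((f t - g) \<bullet> u)\<^sup>2 \<le> 2 * \<eta> * ((f0 - g) \<bullet> u)\<^sup>2
    + 2 * t\<^sup>2 * ((z - K g) \<bullet> (K u /\<^sub>R norm (K u)))\<^sup>2"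
proof -
  define q where "q = (z - K g) \<bullet> K u / (norm (K u))\<^sup>2"
  define a where "a = (f0 - g) \<bullet> u"
  obtain p p' p'' where osc: "damped_oscillator p p' p'' (1 + 2 * s) (norm (K u))"
    and p: "p 0 = a - q" "\<And>t. t \<ge> 0 \<Longrightarrow> (f t - g) \<bullet> u = p t + q"
    using error_coefficient_oscillates[OF K s u f, of g] unfolding q_def a_def by blast
  obtain \<psi> where \<psi>: "p t = \<psi> * p 0" "\<psi>\<^sup>2 \<le> \<eta>" "\<bar>1 - \<psi>\<bar> \<le> norm (K u) * t"
    using factor[OF osc] by blast
  have "(f t - g) \<bullet> u = \<psi> * a + (1 - \<psi>) * q"
    unfolding p(2)[OF t] \<psi>(1) p(1) by (simp add: algebra_simps)
  then have "((f t - g) \<bullet> u)\<^sup>2 = (\<psi> * a + (1 - \<psi>) * q)\<^sup>2"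
    by simp
  also have "\<dots> \<le> 2 * (\<psi> * a)\<^sup>2 + 2 * ((1 - \<psi>) * q)\<^sup>2"
    using sum_squares_bound[of "\<psi> * a" "(1 - \<psi>) * q"] unfolding power2_sum by linarith
  finally have "((f t - g) \<bullet> u)\<^sup>2 \<le> 2 * (\<psi>\<^sup>2 * a\<^sup>2) + 2 * ((1 - \<psi>)\<^sup>2 * q\<^sup>2)"
    by (simp only: power_mult_distrib)
  moreover have "\<psi>\<^sup>2 * a\<^sup>2 \<le> \<eta> * a\<^sup>2"
    using \<psi>(2) by (rule mult_right_mono) simp
  moreover have "(1 - \<psi>)\<^sup>2 * q\<^sup>2 \<le> (norm (K u) * t)\<^sup>2 * q\<^sup>2"
    using power_mono[OF \<psi>(3), of 2] by (intro mult_right_mono) auto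
  moreover have "(norm (K u) * t)\<^sup>2 * q\<^sup>2 = t\<^sup>2 * ((z - K g) \<bullet> (K u /\<^sub>R norm (K u)))\<^sup>2"
    using u by (simp add: singular_vector_def q_def power2_eq_square field_simps)
  ultimately show ?thesis
    unfolding a_def mult.assoc by linarith
qed

lemma eventually_noise_limit:
  "\<forall>\<^sub>F (\<delta>, z) in noise_limit y. \<delta> > 0 \<and> norm (z - y) \<le> \<delta>"
proof -
  have "\<forall>\<^sub>F x in filtercomap fst (at_right (0::real)). fst x > 0"
    by (rule eventually_filtercomapI) (rule eventually_at_right_less)
  then show ?thesis
    unfolding noise_limit_def eventually_inf_principal
    by (rule eventually_mono) auto
qed

theorem theorem1:
  fixes K :: "'q::{real_inner, complete_space} \<Rightarrow> 'y::{real_inner, complete_space}"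
    and s :: real and f0 fdag :: 'q and y :: 'y
    and f :: "real \<Rightarrow> 'y \<Rightarrow> real \<Rightarrow> 'q"
    and T :: "real \<Rightarrow> 'y \<Rightarrow> real"
  assumes "infinite_dimensional (UNIV :: 'q set)"
    and "infinite_dimensional (UNIV :: 'y set)"
    and "compact_operator K"
    and "infinite_dimensional (range K)"
    and "y \<in> range K"
    and "is_arg_min norm (\<lambda>g. K g = y) fdag"
    and "s > -1/2"
    and "\<And>\<delta> z. \<delta> > 0 \<Longrightarrow> norm (z - y) \<le> \<delta> \<Longrightarrow> dynamic_solution K s f0 z (f \<delta> z)"
    and "filterlim (\<lambda>(\<delta>, z). T \<delta> z) at_top (noise_limit y)"
    and "((\<lambda>(\<delta>, z). \<delta> * T \<delta> z) \<longlongrightarrow> 0) (noise_limit y)"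
  shows "((\<lambda>(\<delta>, z). f \<delta> z (T \<delta> z)) \<longlongrightarrow> fdag) (noise_limit y)"
proof (rule tendstoI)
  fix e :: real assume e: "e > 0"
  note K = \<open>compact_operator K\<close> and s = \<open>s > -1/2\<close>
  note blK = bounded_linear_compact_operator[OF K]
  note fdag = \<open>is_arg_min norm (\<lambda>g. K g = y) fdag\<close>
  have Kfdag: "K fdag = y"
    using fdag by (simp add: is_arg_min_def)
  obtain M where M: "orthonormal (\<lambda>u. u) M" "\<And>u. u \<in> M \<Longrightarrow> singular_vector K u"
    "orthogonal_comp (null_space K) \<subseteq> closure (span M)"
    using singular_basis_exists[OF K] by blast
  define a where "a = f0 - fdag"
  \<comment> \<open>There are three contributions to the squared error (the head and the tail of \<open>a\<close>, and the
    noise), each at most \<open>2 * \<epsilon>\<close>; the divisor \<open>7\<close> makes the final inequality strict.\<close>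
  define \<epsilon> where "\<epsilon> = e\<^sup>2 / 7"
  define \<eta> where "\<eta> = \<epsilon> / (1 + (norm a)\<^sup>2)"
  have \<epsilon>: "\<epsilon> > 0"
    using e by (simp add: \<epsilon>_def)
  have a1: "1 + (norm a)\<^sup>2 > 0"
    by (simp add: add_pos_nonneg)
  have \<eta>: "\<eta> > 0" "\<eta> * (norm a)\<^sup>2 \<le> \<epsilon>"
    using \<epsilon> a1 by (auto simp: \<eta>_def field_simps)
  obtain S\<^sub>0 where S\<^sub>0: "finite S\<^sub>0" "S\<^sub>0 \<subseteq> M"
    and tail: "\<And>S. finite S \<Longrightarrow> S \<subseteq> M - S\<^sub>0 \<Longrightarrow> (\<Sum>u\<in>S. (a \<bullet> u)\<^sup>2) \<le> \<epsilon>"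
    using bessel_tail_small[OF M(1) \<epsilon>, of a] by blast
  have "\<exists>t\<^sub>1. \<forall>p p' p'' t. damped_oscillator p p' p'' (1 + 2 * s) (norm (K u)) \<longrightarrow> t \<ge> t\<^sub>1 \<longrightarrow>
    (\<exists>\<psi>. p t = \<psi> * p 0 \<and> \<psi>\<^sup>2 \<le> \<eta> \<and> \<bar>1 - \<psi>\<bar> \<le> norm (K u) * t)" if "u \<in> S\<^sub>0" for u
    using M(2) S\<^sub>0(2) that s \<eta>(1)
    by (intro damped_oscillator_factor_decay) (auto simp: singular_vector_def)
  then obtain t\<^sub>1 where t\<^sub>1: "\<And>u p p' p'' t. u \<in> S\<^sub>0 \<Longrightarrow>
      damped_oscillator p p' p'' (1 + 2 * s) (norm (K u)) \<Longrightarrow> t \<ge> t\<^sub>1 u \<Longrightarrow>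
      (\<exists>\<psi>. p t = \<psi> * p 0 \<and> \<psi>\<^sup>2 \<le> \<eta> \<and> \<bar>1 - \<psi>\<bar> \<le> norm (K u) * t)"
    by metis
  define t\<^sub>0 where "t\<^sub>0 = Max (insert 1 (t\<^sub>1 ` S\<^sub>0))"
  have t\<^sub>0: "1 \<le> t\<^sub>0" "\<And>u. u \<in> S\<^sub>0 \<Longrightarrow> t\<^sub>1 u \<le> t\<^sub>0"
    using S\<^sub>0(1) by (auto simp: t\<^sub>0_def)
  have error: "norm (f \<delta> z (T \<delta> z) - fdag) < e"
    if \<delta>: "\<delta> > 0" "norm (z - y) \<le> \<delta>" and T: "T \<delta> z \<ge> t\<^sub>0" "\<bar>\<delta> * T \<delta> z\<bar> < sqrt \<epsilon>" for \<delta> z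
  proof -
    define t where "t = T \<delta> z"
    define v where "v = f \<delta> z t - fdag"
    define h where "h u = (z - y) \<bullet> (K u /\<^sub>R norm (K u))" for u
    note sol = assms(8)[OF \<delta>]
    have t: "t > 0" "t \<ge> t\<^sub>0"
      using T(1) t\<^sub>0(1) by (auto simp: t_def)
    have noise: "t\<^sup>2 * (norm (z - y))\<^sup>2 \<le> \<epsilon>"
    proof -
      have "norm (z - y) * t \<le> \<delta> * t"
        using \<delta>(2) t(1) by (intro mult_right_mono) auto
      also have "\<dots> \<le> sqrt \<epsilon>"
        using T(2) unfolding t_def by linarith
      finally have "(norm (z - y) * t)\<^sup>2 \<le> (sqrt \<epsilon>)\<^sup>2"
        using t by (intro power_mono) auto
      then show ?thesis
        using \<epsilon> by (simp add: power_mult_distrib mult.commute)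
    qed
    have "(norm v)\<^sup>2 \<le> 6 * \<epsilon>"
    proof (rule norm_le_of_coefficients[OF M(1)])
      have "f \<delta> z t \<in> orthogonal_comp (null_space K)"
        using sol t(1) by (auto simp: dynamic_solution_def)
      then have "v \<in> orthogonal_comp (null_space K)"
        unfolding v_def
        by (intro subspace_diff subspace_orthogonal_comp minimum_norm_solution_orthogonal[OF _ fdag]
            bounded_linear.linear[OF blK])
      then show "v \<in> closure (span M)"
        using M(3) by blast
    next
      fix S assume S: "finite S" "S \<subseteq> M"
      \<comment> \<open>The decay is effective from \<open>t\<^sub>0\<close> on for the finitely many vectors in \<open>S\<^sub>0\<close>; a common time for
        all of \<open>M\<close> need not exist, because the singular values may accumulate at zero.\<close>
      define c where "c u = (if u \<in> S\<^sub>0 then \<eta> else 1)" for u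
      have "(v \<bullet> u)\<^sup>2 \<le> 2 * c u * (a \<bullet> u)\<^sup>2 + 2 * t\<^sup>2 * (h u)\<^sup>2" if u: "u \<in> S" for u
      proof -
        have "singular_vector K u"
          using M(2) S(2) u by blast
        then show ?thesis
          unfolding v_def a_def h_def Kfdag[symmetric]
        proof (rule error_coefficient_le[OF blK s _ sol])
          fix p p' p'' assume osc: "damped_oscillator p p' p'' (1 + 2 * s) (norm (K u))"
          show "\<exists>\<psi>. p t = \<psi> * p 0 \<and> \<psi>\<^sup>2 \<le> c u \<and> \<bar>1 - \<psi>\<bar> \<le> norm (K u) * t"
          proof (cases "u \<in> S\<^sub>0")
            case True
            then show ?thesis
              using t\<^sub>1[OF True osc] t\<^sub>0(2)[OF True] t(2) by (simp add: c_def)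
          next
            case False
            then show ?thesis
              using damped_oscillator.factor_bounded[OF osc t(1)] by (simp add: c_def)
          qed
        qed (use t in simp)
      qed
      then have "(\<Sum>u\<in>S. (v \<bullet> u)\<^sup>2) \<le> (\<Sum>u\<in>S. 2 * c u * (a \<bullet> u)\<^sup>2 + 2 * t\<^sup>2 * (h u)\<^sup>2)"
        by (rule sum_mono)
      also have "\<dots> = 2 * (\<Sum>u\<in>S. c u * (a \<bullet> u)\<^sup>2) + 2 * (t\<^sup>2 * (\<Sum>u\<in>S. (h u)\<^sup>2))"
        by (simp add: sum.distrib sum_distrib_left mult.assoc)
      also have "(\<Sum>u\<in>S. c u * (a \<bullet> u)\<^sup>2) =
          \<eta> * (\<Sum>u\<in>S \<inter> S\<^sub>0. (a \<bullet> u)\<^sup>2) + (\<Sum>u\<in>S - S\<^sub>0. (a \<bullet> u)\<^sup>2)"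
        unfolding sum.Int_Diff[OF S(1), of _ S\<^sub>0] by (simp add: c_def sum_distrib_left)
      also have "\<eta> * (\<Sum>u\<in>S \<inter> S\<^sub>0. (a \<bullet> u)\<^sup>2) \<le> \<eta> * (norm a)\<^sup>2"
        using S \<eta>(1) by (intro mult_left_mono bessel_inequality orthonormal_subset[OF M(1)]) auto
      also note \<eta>(2)
      also have "(\<Sum>u\<in>S - S\<^sub>0. (a \<bullet> u)\<^sup>2) \<le> \<epsilon>"
        using S by (intro tail) auto
      also have "t\<^sup>2 * (\<Sum>u\<in>S. (h u)\<^sup>2) \<le> t\<^sup>2 * (norm (z - y))\<^sup>2"
        unfolding h_def using S
        by (intro mult_left_mono bessel_inequality orthonormal_subset[OF
              orthonormal_image_singular_vectors[OF blK M(1,2)]]) auto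
      also note noise
      finally show "(\<Sum>u\<in>S. (v \<bullet> u)\<^sup>2) \<le> 6 * \<epsilon>"
        by simp
    qed
    also have "6 * \<epsilon> < e\<^sup>2"
      using e by (simp add: \<epsilon>_def)
    finally show ?thesis
      using e unfolding v_def t_def by (simp add: power_less_imp_less_base)
  qed
  have "\<forall>\<^sub>F (\<delta>, z) in noise_limit y. T \<delta> z \<ge> t\<^sub>0"
    using assms(9) by (auto simp: filterlim_at_top case_prod_unfold)
  moreover have "\<forall>\<^sub>F (\<delta>, z) in noise_limit y. \<bar>\<delta> * T \<delta> z\<bar> < sqrt \<epsilon>"
    using tendstoD[OF assms(10), of "sqrt \<epsilon>"] \<epsilon> by (simp add: case_prod_unfold)
  ultimately show "\<forall>\<^sub>F x in noise_limit y. dist (case x of (\<delta>, z) \<Rightarrow> f \<delta> z (T \<delta> z)) fdag < e"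
    using eventually_noise_limit[of y]
    by eventually_elim (auto simp: dist_norm intro: error)
qed

end
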